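(* There exist a sequence $\{z_k\}_{k=0}^\infty$ of distinct points in the open unit disk $\mathbb{D}$ and a sequence $\{w_k\}_{k=0}^\infty$ of complex numbers such that the Nevanlinna--Pick problem $f(z_k)=w_k$, $k=0,1,2,\ldots$, has infinitely many solutions $f$ in the Schur class (i.e. is indeterminate), and yet $\lambda_0(P)=0$.
   Context: The Schur class $\mathcal{S}$ is the set of analytic functions $f$ on $\mathbb{D}$ with $|f|\le 1$. The Nevanlinna--Pick problem with data $\{z_k,w_k\}_{k=0}^\infty$ asks for all $f\in\mathcal{S}$ with $f(z_k)=w_k$ for every $k\ge 0$. Its Pick matrices are $$P_n=\left\|\frac{1-w_i\overline{w_j}}{1-z_i\overline{z_j}}\right\|_{i,j=0}^n,\qquad n=0,1,2,\ldots,$$ which are nonnegative for all $n$ when the problem is solvable. Let $\lambda_{n,0}$ be the smallest eigenvalue of $P_n$. By eigenvalue interlacing $\lambda_{n,0}$ is non-increasing in $n$, and one sets $\lambda_0(P)=\lim_{n\to\infty}\lambda_{n,0}$. *)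

theory Defs
  imports
    "HOL-Analysis.Analysis"
    "Jordan_Normal_Form.Spectral_Radius"
begin

abbreviation unit_disk :: "complex set" where
  "unit_disk \<equiv> ball 0 1"

(* HOL functions are total. Requiring f to take the fixed value undefined off the disk
   (membership in extensional) makes two Schur functions equal exactly when they agree on the
   disk, so that cardinalities of sets of Schur functions are the intended ones. *)
definition schur_class :: "(complex \<Rightarrow> complex) set" where
  "schur_class = {f \<in> extensional unit_disk.
     f holomorphic_on unit_disk \<and> (\<forall>x \<in> unit_disk. norm (f x) \<le> 1)}"

definition np_solutions :: "(nat \<Rightarrow> complex) \<Rightarrow> (nat \<Rightarrow> complex) \<Rightarrow> (complex \<Rightarrow> complex) set" where
  "np_solutions z w = {f \<in> schur_class. \<forall>k. f (z k) = w k}"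

definition pick_matrix :: "(nat \<Rightarrow> complex) \<Rightarrow> (nat \<Rightarrow> complex) \<Rightarrow> nat \<Rightarrow> complex mat" where
  "pick_matrix z w n = Matrix.mat (Suc n) (Suc n)
     (\<lambda>(i, j). (1 - w i * cnj (w j)) / (1 - z i * cnj (z j)))"

(* A Pick matrix is Hermitian, so its eigenvalues are real and Re merely moves them from
   complex to real, where they can be compared. The spectrum of a complex matrix of positive
   size is finite and nonempty, so Min is well defined. *)
definition smallest_eigenvalue :: "complex mat \<Rightarrow> real" where
  "smallest_eigenvalue A = Min (Re ` spectrum A)"

end

theory Submission
  imports Defs "HOL-Real_Asymp.Real_Asymp"
begin

text \<open>
  All targets are \<open>w k = 0\<close>, so that the solutions are the Schur functions vanishing at every node,
  and the Pick matrices are the Gram matrices of the Szego kernel \<open>1 / (1 - z i * cnj (z j))\<close>.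
  As soon as one Schur function \<open>f\<close> other than \<open>0\<close> vanishes at the nodes, all \<open>c f\<close> with
  \<open>0 \<le> c \<le> 1\<close> are solutions (\<open>infinite_np_solutions_if_vanishing\<close>). A Gram matrix has no
  negative eigenvalue (\<open>szego_kernel_nonneg\<close>), and its smallest eigenvalue is at most the Rayleigh
  quotient of the difference of two neighbouring unit vectors (\<open>smallest_eigenvalue_le_pair\<close>),
  which for real nodes \<open>a\<close>, \<open>b\<close> equals
  \<open>(a - b)\<^sup>2 (1 + a b) / (2 (1 - a\<^sup>2) (1 - b\<^sup>2) (1 - a b))\<close>.
  It remains to let the nodes crowd together so fast that this tends to \<open>0\<close>, but tend to the circle
  so fast that they are still the zeros of a bounded function.

  Nodes with \<open>1 - z k\<close> of the order of \<open>k powr - p\<close> have gaps of the order of \<open>k powr (- p - 1)\<close>,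
  so the quotient is of the order of \<open>k powr (p - 2)\<close> and tends to \<open>0\<close> if \<open>p < 2\<close>; the Blaschke
  condition demands \<open>p > 1\<close>. The nodes below have \<open>p = 3/2\<close>: the Cayley transform from the disk to
  the right half plane sends them to \<open>1, 2 powr (3/2), 3 powr (3/2), \<dots>\<close>. This makes the
  vanishing function explicit. The power \<open>2/3\<close> maps the half plane to the sector
  \<open>\<bar>arg u\<bar> < \<pi> / 3\<close> and the nodes to \<open>1, 2, 3, \<dots>\<close>, where \<open>sin (\<pi> u)\<close> vanishes; in the sector
  \<open>\<bar>Im u\<bar> \<le> sqrt 3 * Re u\<close>, so the factor \<open>exp (- sqrt 3 \<pi> u)\<close> makes up for the
  growth of the sine.
\<close>

unbundle no vec_syntax

section \<open>The smallest eigenvalue as minimum of the Rayleigh quotient\<close>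

lemma linear_coeff_eq_0_if_nonneg:
  fixes b c :: real
  assumes "\<And>t. 0 \<le> b * t + c * t\<^sup>2"
  shows "b = 0"
proof (rule ccontr)
  assume "b \<noteq> 0"
  define D where "D = \<bar>c\<bar> + 1"
  have D: "D > 0" "c < D" by (auto simp: D_def)
  \<comment> \<open>At \<open>t = - b / D\<close> the linear term wins, because \<open>c < D\<close>.\<close>
  have "b * (- b / D) + c * (- b / D)\<^sup>2 = b\<^sup>2 * (c - D) / D\<^sup>2"
    using D by (simp add: field_simps power2_eq_square)
  also have "\<dots> < 0"
    using D \<open>b \<noteq> 0\<close> by (intro divide_neg_pos mult_pos_neg) auto
  finally show False using assms[of "- b / D"] by simp
qed

text \<open>
  The dimension varies with \<open>n\<close>, so vectors are sequences whose first \<open>Suc n\<close> entries count. Bounding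
  the remaining entries makes the sphere a closed part of a cube, which is compact in the product
  topology by Tychonoff's theorem.
\<close>

lemma compact_unit_sphere_coords:
  "compact {x :: nat \<Rightarrow> real. (\<forall>i. x i \<in> {-1..1}) \<and> (\<Sum>i\<le>n. (x i)\<^sup>2) = 1}"
proof -
  have "compactin (product_topology (\<lambda>_. euclidean) UNIV) (PiE UNIV (\<lambda>i::nat. {-1..1::real}))"
    by (simp add: compactin_PiE)
  hence 1: "compact {x :: nat \<Rightarrow> real. \<forall>i. x i \<in> {-1..1}}"
    by (simp add: euclidean_product_topology PiE_def Pi_def)
  have 2: "closed {x :: nat \<Rightarrow> real. (\<Sum>i\<le>n. (x i)\<^sup>2) = 1}"
    by (intro closed_Collect_eq continuous_intros continuous_on_product_coordinates)
  show ?thesis using compact_Int_closed[OF 1 2]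
    by (simp add: Int_def)
qed

text \<open>
  By compactness the quadratic form has a minimum \<open>m\<close> on the unit sphere, say at \<open>v\<close>. Then
  \<open>Q x - m * (norm x)\<^sup>2\<close> is nonnegative everywhere and \<open>0\<close> at \<open>v\<close>. Moving from \<open>v\<close> by \<open>t\<close> in
  the direction of the \<open>k\<close>-th unit vector gives a nonnegative quadratic polynomial in \<open>t\<close> without
  constant term; its linear coefficient, twice the \<open>k\<close>-th entry of \<open>a v - m v\<close>, must vanish.
\<close>

lemma symmetric_rayleigh_minimum:
  fixes a :: "nat \<Rightarrow> nat \<Rightarrow> real"
  assumes sym: "\<And>i j. a i j = a j i"
  obtains m v where
    "(\<Sum>i\<le>n. (v i)\<^sup>2) = 1"
    "\<And>i. i \<le> n \<Longrightarrow> (\<Sum>j\<le>n. a i j * v j) = m * v i"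
    "\<And>x. m * (\<Sum>i\<le>n. (x i)\<^sup>2) \<le> (\<Sum>i\<le>n. \<Sum>j\<le>n. a i j * x i * x j)"
    "m = (\<Sum>i\<le>n. \<Sum>j\<le>n. a i j * v i * v j)"
proof -
  define Q where "Q x = (\<Sum>i\<le>n. \<Sum>j\<le>n. a i j * x i * x j)" for x
  define S where "S = {x :: nat \<Rightarrow> real. (\<forall>i. x i \<in> {-1..1}) \<and> (\<Sum>i\<le>n. (x i)\<^sup>2) = 1}"
  have "compact S" unfolding S_def by (rule compact_unit_sphere_coords)
  moreover have "(\<lambda>i. if i = 0 then 1 else 0) \<in> S"
    by (auto simp: S_def if_distrib[of "\<lambda>x. x\<^sup>2"] cong: if_cong)
  hence "S \<noteq> {}" by blast
  moreover have "continuous_on S Q"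
    unfolding Q_def
    by (intro continuous_intros continuous_on_subset[OF continuous_on_product_coordinates]) auto
  ultimately obtain v where v: "v \<in> S" "\<And>x. x \<in> S \<Longrightarrow> Q v \<le> Q x"
    using continuous_attains_inf[of S Q] by metis
  have v1: "(\<Sum>i\<le>n. (v i)\<^sup>2) = 1" using v by (auto simp: S_def)
  have min: "Q v * (\<Sum>i\<le>n. (x i)\<^sup>2) \<le> Q x" for x
  proof (cases "(\<Sum>i\<le>n. (x i)\<^sup>2) = 0")
    case True
    hence "\<forall>i\<in>{..n}. x i = 0" by (subst (asm) sum_nonneg_eq_0_iff) auto
    thus ?thesis using True by (simp add: Q_def)
  next
    case False
    define s where "s = (\<Sum>i\<le>n. (x i)\<^sup>2)"
    have s: "s > 0" using False sum_nonneg[of "{..n}" "\<lambda>i. (x i)\<^sup>2"] by (simp add: s_def)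
    define y where "y i = (if i \<le> n then x i / sqrt s else 0)" for i
    have ysum: "(\<Sum>i\<le>n. (y i)\<^sup>2) = 1"
      using s by (simp add: y_def power_divide flip: sum_divide_distrib s_def)
    have "\<bar>y i\<bar> \<le> 1" for i
    proof (cases "i \<le> n")
      case True
      have "(y i)\<^sup>2 \<le> (\<Sum>i\<le>n. (y i)\<^sup>2)" using True by (intro member_le_sum) auto
      thus ?thesis using ysum by (simp add: abs_square_le_1)
    qed (simp add: y_def)
    hence "y \<in> S" using ysum by (auto simp: S_def abs_le_iff minus_le_iff)
    hence "Q v \<le> Q y" by (rule v)
    also have "Q y = (\<Sum>i\<le>n. \<Sum>j\<le>n. a i j * x i * x j / s)"
      unfolding Q_def y_def using s
      by (intro sum.cong refl) (simp add: field_simps)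
    also have "\<dots> = Q x / s" by (simp add: Q_def sum_divide_distrib)
    finally show ?thesis using s by (simp add: field_simps flip: s_def)
  qed
  have ev: "(\<Sum>j\<le>n. a k j * v j) = Q v * v k" if k: "k \<le> n" for k
  proof -
    define A where "A = (\<Sum>j\<le>n. a k j * v j)"
    have A': "(\<Sum>i\<le>n. a i k * v i) = A" unfolding A_def by (intro sum.cong) (auto simp: sym)
    have "0 \<le> (2 * (A - Q v * v k)) * t + (a k k - Q v) * t\<^sup>2" for t
    proof -
      define e where "e i = (if i = k then t else 0)" for i
      have se: "(\<Sum>i\<le>n. f i * e i) = f k * t" for f
        unfolding e_def using k by (simp add: if_distrib cong: if_cong)
      have "(\<Sum>i\<le>n. (v i + e i)\<^sup>2) = (\<Sum>i\<le>n. (v i)\<^sup>2) + 2 * (\<Sum>i\<le>n. v i * e i) + (\<Sum>i\<le>n. e i * e i)"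
        by (simp add: power2_eq_square algebra_simps sum.distrib sum_distrib_left)
      also have "\<dots> = 1 + 2 * v k * t + t\<^sup>2"
        unfolding se v1 by (simp add: e_def power2_eq_square)
      finally have n1: "(\<Sum>i\<le>n. (v i + e i)\<^sup>2) = 1 + 2 * v k * t + t\<^sup>2" .
      have "Q (\<lambda>i. v i + e i) = Q v + (\<Sum>i\<le>n. \<Sum>j\<le>n. (a i j * v i) * e j)
          + (\<Sum>i\<le>n. (\<Sum>j\<le>n. a i j * v j) * e i) + (\<Sum>i\<le>n. (\<Sum>j\<le>n. a i j * e j) * e i)"
        unfolding Q_def sum_distrib_right
        by (simp add: algebra_simps sum.distrib)
      also have "\<dots> = Q v + A * t + A * t + a k k * t * t"
        unfolding se by (simp add: A_def A'[unfolded A_def] flip: sum_distrib_right)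
      finally have "Q (\<lambda>i. v i + e i) = Q v + 2 * A * t + a k k * t\<^sup>2"
        by (simp add: power2_eq_square)
      with min[of "\<lambda>i. v i + e i"] n1 show ?thesis by (simp add: algebra_simps)
    qed
    from linear_coeff_eq_0_if_nonneg[OF this] show ?thesis by (simp add: A_def)
  qed
  show ?thesis
    by (rule that[OF v1 ev]) (use min in \<open>auto simp: Q_def\<close>)
qed

abbreviation real_matrix :: "(nat \<Rightarrow> nat \<Rightarrow> real) \<Rightarrow> nat \<Rightarrow> complex mat" where
  "real_matrix a n \<equiv> Matrix.mat (Suc n) (Suc n) (\<lambda>(i, j). complex_of_real (a i j))"

text \<open>
  The minimum \<open>m\<close> of the Rayleigh quotient is an eigenvalue by \<open>symmetric_rayleigh_minimum\<close>.
  No eigenvalue \<open>l\<close> has a smaller real part: if \<open>c = x + \<i> y\<close> is an eigenvector, the real part of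
  \<open>c\<^sup>* M c = l * (norm c)\<^sup>2\<close> is \<open>Q x + Q y\<close>, which is at least \<open>m * (norm c)\<^sup>2\<close>.
\<close>

lemma smallest_eigenvalue_rayleigh:
  fixes a :: "nat \<Rightarrow> nat \<Rightarrow> real"
  assumes sym: "\<And>i j. a i j = a j i"
  shows smallest_eigenvalue_le_rayleigh:
      "smallest_eigenvalue (real_matrix a n) * (\<Sum>i\<le>n. (x i)\<^sup>2)
         \<le> (\<Sum>i\<le>n. \<Sum>j\<le>n. a i j * x i * x j)"
    and smallest_eigenvalue_attained:
      "\<exists>v. smallest_eigenvalue (real_matrix a n) = (\<Sum>i\<le>n. \<Sum>j\<le>n. a i j * v i * v j)"
proof -
  define M where "M = real_matrix a n"
  have M: "M \<in> carrier_mat (Suc n) (Suc n)" by (simp add: M_def)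
  have Mv: "(M *\<^sub>v u) $ i = (\<Sum>j\<le>n. complex_of_real (a i j) * u $ j)"
    if "u \<in> carrier_vec (Suc n)" "i \<le> n" for u i
    using that by (auto simp: M_def scalar_prod_def atLeast0LessThan lessThan_Suc_atMost
        intro!: sum.cong)
  obtain m v where v1: "(\<Sum>i\<le>n. (v i)\<^sup>2) = 1"
    and ev: "\<And>i. i \<le> n \<Longrightarrow> (\<Sum>j\<le>n. a i j * v j) = m * v i"
    and min: "\<And>x. m * (\<Sum>i\<le>n. (x i)\<^sup>2) \<le> (\<Sum>i\<le>n. \<Sum>j\<le>n. a i j * x i * x j)"
    and m: "m = (\<Sum>i\<le>n. \<Sum>j\<le>n. a i j * v i * v j)"
    by (rule symmetric_rayleigh_minimum[OF sym, of n]) (rule that)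
  have fin: "finite (spectrum M)" using card_finite_spectrum(1)[OF M] .
  define u where "u = Matrix.vec (Suc n) (\<lambda>i. complex_of_real (v i))"
  have u: "u \<in> carrier_vec (Suc n)" by (simp add: u_def)
  have "u \<noteq> 0\<^sub>v (Suc n)"
  proof
    assume "u = 0\<^sub>v (Suc n)"
    hence "v i = 0" if "i \<le> n" for i
      using that by (auto simp: u_def Matrix.vec_eq_iff)
    thus False using v1 by simp
  qed
  moreover have "M *\<^sub>v u = complex_of_real m \<cdot>\<^sub>v u"
  proof (rule eq_vecI)
    fix i assume "i < dim_vec (complex_of_real m \<cdot>\<^sub>v u)"
    hence i: "i \<le> n" by (simp add: u_def)
    have "(M *\<^sub>v u) $ i = complex_of_real (\<Sum>j\<le>n. a i j * v j)"
      using i by (subst Mv) (auto simp: u_def)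
    thus "(M *\<^sub>v u) $ i = (complex_of_real m \<cdot>\<^sub>v u) $ i"
      using i ev by (simp add: u_def)
  qed (simp add: M_def u_def)
  ultimately have "eigenvalue M (complex_of_real m)"
    unfolding eigenvalue_def eigenvector_def using M u by auto
  hence mem: "m \<in> Re ` spectrum M" unfolding spectrum_def by force
  have lower: "m \<le> Re l" if "l \<in> spectrum M" for l
  proof -
    from that obtain c where c: "c \<in> carrier_vec (Suc n)" "c \<noteq> 0\<^sub>v (Suc n)"
      "M *\<^sub>v c = l \<cdot>\<^sub>v c"
      using M by (auto simp: spectrum_def eigenvalue_def eigenvector_def)
    have eq: "(\<Sum>j\<le>n. complex_of_real (a i j) * c $ j) = l * c $ i" if "i \<le> n" for i
      using Mv[OF c(1) that] c(1) that unfolding c(3) by auto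
    define x where "x i = Re (c $ i)" for i
    define y where "y i = Im (c $ i)" for i
    define s where "s = (\<Sum>i\<le>n. (x i)\<^sup>2) + (\<Sum>i\<le>n. (y i)\<^sup>2)"
    have s0: "s > 0"
    proof -
      have "\<exists>i\<le>n. c $ i \<noteq> 0" using c(1,2) by (auto simp: Matrix.vec_eq_iff less_Suc_eq_le)
      then obtain i where i: "i \<le> n" "c $ i \<noteq> 0" by blast
      have "0 < (x i)\<^sup>2 + (y i)\<^sup>2"
        using i(2) by (simp add: x_def y_def sum_power2_gt_zero_iff complex_eq_iff)
      also have "\<dots> \<le> s"
        unfolding s_def using i(1) by (intro add_mono member_le_sum) auto
      finally show ?thesis .
    qed
    have "(\<Sum>i\<le>n. (\<Sum>j\<le>n. complex_of_real (a i j) * c $ j) * cnj (c $ i))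
        = l * (\<Sum>i\<le>n. c $ i * cnj (c $ i))"
      unfolding sum_distrib_left by (intro sum.cong) (auto simp: eq)
    also have "(\<Sum>i\<le>n. c $ i * cnj (c $ i)) = complex_of_real s"
      by (simp add: s_def x_def y_def complex_mult_cnj sum.distrib)
    finally have "(\<Sum>i\<le>n. (\<Sum>j\<le>n. complex_of_real (a i j) * c $ j) * cnj (c $ i))
        = l * complex_of_real s" .
    hence "Re (\<Sum>i\<le>n. \<Sum>j\<le>n. complex_of_real (a i j) * c $ j * cnj (c $ i)) = Re l * s"
      by (simp add: sum_distrib_right)
    moreover have "Re (complex_of_real (a i j) * c $ j * cnj (c $ i))
        = a i j * x i * x j + a i j * y i * y j" for i j
      by (simp add: x_def y_def algebra_simps)
    ultimately have "(\<Sum>i\<le>n. \<Sum>j\<le>n. a i j * x i * x j) + (\<Sum>i\<le>n. \<Sum>j\<le>n. a i j * y i * y j)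
        = Re l * s"
      by (simp only: Re_sum sum.distrib)
    with min[of x] min[of y] have "m * s \<le> Re l * s" by (simp add: s_def algebra_simps)
    thus ?thesis using s0 by simp
  qed
  have "smallest_eigenvalue M = m"
    unfolding smallest_eigenvalue_def
    using fin mem lower by (intro Min_eqI) auto
  thus "smallest_eigenvalue (real_matrix a n) * (\<Sum>i\<le>n. (x i)\<^sup>2)
         \<le> (\<Sum>i\<le>n. \<Sum>j\<le>n. a i j * x i * x j)"
    and "\<exists>v. smallest_eigenvalue (real_matrix a n) = (\<Sum>i\<le>n. \<Sum>j\<le>n. a i j * v i * v j)"
    using min m unfolding M_def by blast+
qed

lemma smallest_eigenvalue_le_pair:
  fixes a :: "nat \<Rightarrow> nat \<Rightarrow> real"
  assumes sym: "\<And>i j. a i j = a j i"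
  shows "smallest_eigenvalue (real_matrix a (Suc n))
    \<le> (a n n + a (Suc n) (Suc n) - 2 * a n (Suc n)) / 2"
proof -
  define x where "x i = (if i = n then 1 else if i = Suc n then -1 else 0 :: real)" for i
  have s: "(\<Sum>i\<le>Suc n. f i * x i) = f n - f (Suc n)" for f
  proof -
    have "(\<Sum>i\<le>Suc n. f i * x i) = (\<Sum>i\<in>{n, Suc n}. f i * x i)"
      by (rule sum.mono_neutral_right) (auto simp: x_def)
    thus ?thesis by (simp add: x_def)
  qed
  have n2: "(\<Sum>i\<le>Suc n. (x i)\<^sup>2) = 2"
    unfolding power2_eq_square s by (simp add: x_def)
  have "(\<Sum>i\<le>Suc n. \<Sum>j\<le>Suc n. a i j * x i * x j)
      = (\<Sum>i\<le>Suc n. (a i n - a i (Suc n)) * x i)"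
    by (intro sum.cong refl) (unfold s, simp add: left_diff_distrib)
  also have "\<dots> = a n n + a (Suc n) (Suc n) - 2 * a n (Suc n)"
    unfolding s using sym[of n "Suc n"] by simp
  finally show ?thesis
    using smallest_eigenvalue_le_rayleigh[of a "Suc n" x] sym unfolding n2 by simp
qed

section \<open>Positivity of the Szego kernel\<close>

text \<open>
  Expanding the kernel in a geometric series turns the quadratic form into a series of squares.
\<close>

lemma szego_kernel_nonneg:
  fixes z x :: "nat \<Rightarrow> real"
  assumes z: "\<And>i. \<bar>z i\<bar> < 1"
  shows "0 \<le> (\<Sum>i\<le>n. \<Sum>j\<le>n. 1 / (1 - z i * z j) * x i * x j)"
proof -
  have "\<bar>z i * z j\<bar> < 1" for i j
    using z[of i] z[of j] by (metis abs_mult abs_ge_zero mult_strict_mono' mult_1)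
  hence "(\<lambda>k. (z i * z j) ^ k * x i * x j) sums (1 / (1 - z i * z j) * x i * x j)" for i j
    by (intro sums_mult2 geometric_sums) auto
  hence "(\<lambda>k. \<Sum>i\<le>n. \<Sum>j\<le>n. (z i * z j) ^ k * x i * x j) sums
      (\<Sum>i\<le>n. \<Sum>j\<le>n. 1 / (1 - z i * z j) * x i * x j)"
    by (intro sums_sum)
  moreover have "(\<Sum>i\<le>n. \<Sum>j\<le>n. (z i * z j) ^ k * x i * x j) = (\<Sum>i\<le>n. z i ^ k * x i)\<^sup>2" for k
    by (simp add: power2_eq_square sum_product power_mult_distrib algebra_simps)
  ultimately have "(\<lambda>k. (\<Sum>i\<le>n. z i ^ k * x i)\<^sup>2) sums
      (\<Sum>i\<le>n. \<Sum>j\<le>n. 1 / (1 - z i * z j) * x i * x j)" by simp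
  thus ?thesis by (rule sums_le[OF _ sums_zero, rotated]) simp
qed

section \<open>Nodes that crowd together\<close>

definition node :: "nat \<Rightarrow> real" where
  "node k = (real (Suc k) powr (3/2) - 1) / (real (Suc k) powr (3/2) + 1)"

lemma abs_node_less_1: "\<bar>node k\<bar> < 1"
proof -
  define r where "r = real (Suc k) powr (3/2)"
  have "r > 0" by (simp add: r_def)
  hence "\<bar>(r - 1) / (r + 1)\<bar> < 1" unfolding abs_less_iff by (simp add: field_simps)
  thus ?thesis by (simp only: node_def r_def)
qed

lemma inj_node: "inj node"
proof (rule injI)
  fix k l assume eq: "node k = node l"
  define r s where "r = real (Suc k) powr (3/2)" and "s = real (Suc l) powr (3/2)"
  have "r > 0" "s > 0" by (simp_all add: r_def s_def)
  moreover have "(r - 1) / (r + 1) = (s - 1) / (s + 1)"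
    using eq by (simp only: node_def r_def s_def)
  ultimately have "r = s" by (simp add: field_simps)
  hence "r powr (2/3) = s powr (2/3)" by simp
  thus "k = l" by (simp add: r_def s_def powr_powr)
qed

text \<open>
  The three terms each grow like \<open>n powr (3/2)\<close>, but cancel up to the order \<open>n powr (- 1/2)\<close>.
\<close>

lemma node_rayleigh_tendsto_0:
  "(\<lambda>n. (1 / (1 - node n * node n) + 1 / (1 - node (Suc n) * node (Suc n))
      - 2 * (1 / (1 - node n * node (Suc n)))) / 2) \<longlonglongrightarrow> 0"
  unfolding node_def of_nat_Suc by real_asymp

section \<open>A bounded function vanishing at the nodes\<close>

definition cayley :: "complex \<Rightarrow> complex" where
  "cayley z = (1 + z) / (1 - z)"

text \<open>
  The principal branch of \<open>cayley z powr (2/3)\<close>; its values lie in the sector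
  \<open>\<bar>arg u\<bar> < \<pi> / 3\<close>.
\<close>

definition sector :: "complex \<Rightarrow> complex" where
  "sector z = exp (2/3 * Ln (cayley z))"

definition node_function :: "complex \<Rightarrow> complex" where
  "node_function z = sin (of_real pi * sector z) * exp (- of_real (sqrt 3 * pi) * sector z)"

lemma Re_cayley_pos:
  assumes "norm z < 1"
  shows "Re (cayley z) > 0"
proof -
  have "(norm z)\<^sup>2 < 1" using assms by (simp add: abs_square_less_1)
  hence "Re ((1 + z) * cnj (1 - z)) > 0"
    unfolding cmod_power2 by (simp add: algebra_simps power2_eq_square)
  thus ?thesis unfolding cayley_def Re_complex_div_gt_0 .
qed

text \<open>
  With \<open>t\<close> the argument of \<open>sector z\<close>, the claim is \<open>\<bar>sin t\<bar> \<le> sqrt 3 * cos t\<close>, which says that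
  \<open>sin (\<pi>/3 - t)\<close> and \<open>sin (\<pi>/3 + t)\<close> are nonnegative.
\<close>

lemma sector_bound:
  assumes "norm z < 1"
  shows "\<bar>Im (sector z)\<bar> \<le> sqrt 3 * Re (sector z)"
proof -
  define t where "t = 2/3 * Im (Ln (cayley z))"
  have c: "Re (cayley z) > 0" using Re_cayley_pos[OF assms] .
  hence "cayley z \<noteq> 0" by auto
  hence "\<bar>Im (Ln (cayley z))\<bar> < pi / 2" using c Re_Ln_pos_lt by blast
  hence t: "\<bar>t\<bar> < pi / 3" by (simp add: t_def)
  have "sin (pi/3 - t) \<ge> 0" "sin (pi/3 + t) \<ge> 0"
    using t by (auto intro!: sin_ge_zero)
  hence "\<bar>sin t\<bar> \<le> sqrt 3 * cos t"
    by (simp add: sin_diff sin_add sin_60 cos_60)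
  moreover have "Im (sector z) = exp (Re (2/3 * Ln (cayley z))) * sin t"
    "Re (sector z) = exp (Re (2/3 * Ln (cayley z))) * cos t"
    unfolding sector_def Im_exp Re_exp t_def by simp_all
  ultimately show ?thesis by (simp add: abs_mult)
qed

lemma norm_sin_le_exp_abs_Im: "norm (sin (z::complex)) \<le> exp \<bar>Im z\<bar>"
proof -
  have "norm (sin z) = norm (exp (\<i> * z) - exp (- (\<i> * z))) / 2"
    by (simp add: sin_exp_eq norm_divide norm_mult)
  also have "\<dots> \<le> (norm (exp (\<i> * z)) + norm (exp (- (\<i> * z)))) / 2"
    by (intro divide_right_mono norm_triangle_ineq4) auto
  also have "\<dots> \<le> (exp \<bar>Im z\<bar> + exp \<bar>Im z\<bar>) / 2"
    by (intro divide_right_mono add_mono) auto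
  finally show ?thesis by simp
qed

lemma norm_node_function_le_1:
  assumes "norm z < 1"
  shows "norm (node_function z) \<le> 1"
proof -
  have "norm (node_function z) \<le> exp \<bar>Im (of_real pi * sector z)\<bar> * exp (- (sqrt 3 * pi) * Re (sector z))"
    unfolding node_function_def norm_mult
    by (intro mult_mono norm_sin_le_exp_abs_Im) auto
  also have "\<dots> = exp (pi * (\<bar>Im (sector z)\<bar> - sqrt 3 * Re (sector z)))"
    by (simp add: abs_mult algebra_simps flip: exp_add)
  also have "\<dots> \<le> 1" using sector_bound[OF assms] by (simp add: mult_le_0_iff)
  finally show ?thesis .
qed

lemma node_function_holomorphic: "node_function holomorphic_on ball 0 1"
proof -
  have "cayley z \<notin> \<real>\<^sub>\<le>\<^sub>0" if "z \<in> ball 0 1" for z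
    using Re_cayley_pos[of z] that by (auto simp: complex_nonpos_Reals_iff)
  moreover have "cayley holomorphic_on ball 0 1"
    unfolding cayley_def by (intro holomorphic_intros) auto
  ultimately show ?thesis unfolding node_function_def sector_def
    by (intro holomorphic_intros holomorphic_on_sin[unfolded o_def]
        holomorphic_on_exp[unfolded o_def])
qed

lemma sector_inverse:
  assumes "t > (0::real)"
  shows "sector (of_real ((t powr (3/2) - 1) / (t powr (3/2) + 1))) = of_real t"
proof -
  define r where "r = t powr (3/2)"
  have r: "r > 0" using assms by (simp add: r_def)
  have "(1 + (r - 1) / (r + 1)) / (1 - (r - 1) / (r + 1)) = r"
    using r by (simp add: divide_simps) 
  hence "cayley (of_real ((r - 1) / (r + 1))) = of_real r"
    unfolding cayley_def by (metis of_real_1 of_real_add of_real_diff of_real_divide)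
  hence "sector (of_real ((r - 1) / (r + 1))) = of_real (exp (2/3 * ln r))"
    using r by (simp add: sector_def Ln_of_real exp_of_real[symmetric])
  also have "exp (2/3 * ln r) = t"
    using assms by (simp add: r_def ln_powr)
  finally show ?thesis by (simp add: r_def)
qed

lemma node_function_node: "node_function (of_real (node k)) = 0"
proof -
  have "sin (complex_of_real pi * of_real (real (Suc k))) = of_real (sin (real (Suc k) * pi))"
    by (simp add: sin_of_real[symmetric] mult.commute)
  also have "\<dots> = 0" by (simp only: sin_npi of_real_0)
  finally show ?thesis
    unfolding node_function_def node_def by (subst sector_inverse) auto
qed

text \<open>The witness is the point that \<open>sector\<close> maps to \<open>1/2\<close>, midway between two zeros of the sine.\<close>

lemma node_function_nonzero: "\<exists>z. norm z < 1 \<and> node_function z \<noteq> 0"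
proof -
  define r where "r = (1/2::real) powr (3/2)"
  define z where "z = complex_of_real ((r - 1) / (r + 1))"
  have "r > 0" by (simp add: r_def)
  hence "\<bar>(r - 1) / (r + 1)\<bar> < 1" unfolding abs_less_iff by (simp add: field_simps)
  hence "norm z < 1" by (simp only: z_def norm_of_real)
  have "sector z = of_real (1/2)"
    unfolding z_def r_def by (rule sector_inverse) simp
  moreover have "sin (complex_of_real pi * of_real (1/2)) = of_real (sin (pi * (1/2)))"
    by (simp only: sin_of_real of_real_mult[symmetric])
  ultimately have "node_function z \<noteq> 0"
    by (simp add: node_function_def del: of_real_divide)
  thus ?thesis using \<open>norm z < 1\<close> by blast
qed

lemma infinite_np_solutions_if_vanishing:
  assumes z: "range z \<subseteq> ball 0 1"
    and hol: "f holomorphic_on ball 0 1"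
    and bound: "\<And>x. norm x < 1 \<Longrightarrow> norm (f x) \<le> 1"
    and zero: "\<And>k. f (z k) = 0"
    and p: "norm p < 1" "f p \<noteq> 0"
  shows "infinite (np_solutions z (\<lambda>_. 0))"
proof -
  define g where "g c = restrict (\<lambda>x. of_real c * f x) unit_disk" for c :: real
  have "g c \<in> np_solutions z (\<lambda>_. 0)" if "c \<in> {0..1}" for c
  proof -
    have "g c holomorphic_on unit_disk"
      by (rule holomorphic_transform[of "\<lambda>x. of_real c * f x"])
        (auto simp: g_def intro!: holomorphic_intros hol)
    moreover have "norm (g c x) \<le> 1" if "x \<in> unit_disk" for x
      using that \<open>c \<in> {0..1}\<close> bound[of x] by (auto simp: g_def norm_mult intro: mult_le_one)
    ultimately show ?thesis
      using zero z by (auto simp: np_solutions_def schur_class_def g_def image_subset_iff)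
  qed
  hence sub: "g ` {0..1} \<subseteq> np_solutions z (\<lambda>_. 0)" by blast
  have "inj_on g {0..1}"
  proof (rule inj_onI)
    fix c d assume "g c = g d"
    hence "g c p = g d p" by simp
    thus "c = d" using p by (simp add: g_def)
  qed
  hence "infinite (g ` {0..1})" by (simp add: finite_image_iff infinite_Icc)
  thus ?thesis using sub infinite_super by blast
qed

section \<open>The example\<close>

theorem mainTheorem2:
  shows "\<exists>(z :: nat \<Rightarrow> complex) (w :: nat \<Rightarrow> complex).
    inj z \<and> range z \<subseteq> unit_disk \<and>
    infinite (np_solutions z w) \<and>
    (\<lambda>n. smallest_eigenvalue (pick_matrix z w n)) \<longlonglongrightarrow> 0"
proof -
  define z where "z k = complex_of_real (node k)" for k
  define a where "a i j = 1 / (1 - node i * node j)" for i j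
  have sym: "a i j = a j i" for i j by (simp add: a_def mult.commute)
  have P: "pick_matrix z (\<lambda>_. 0) n = real_matrix a n" for n
    by (auto simp: pick_matrix_def z_def a_def intro!: eq_matI)
  have disk: "range z \<subseteq> unit_disk" using abs_node_less_1 by (auto simp: z_def)
  have "inj z" using inj_node by (auto simp: z_def inj_def)
  moreover have "infinite (np_solutions z (\<lambda>_. 0))"
    using node_function_nonzero infinite_np_solutions_if_vanishing[OF disk
        node_function_holomorphic norm_node_function_le_1]
    by (auto simp: z_def node_function_node)
  moreover have "(\<lambda>n. smallest_eigenvalue (real_matrix a n)) \<longlonglongrightarrow> 0"
  proof (rule LIMSEQ_imp_Suc, rule tendsto_sandwich[OF _ _ tendsto_const])
    show "\<forall>\<^sub>F n in sequentially. 0 \<le> smallest_eigenvalue (real_matrix a (Suc n))"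
    proof (rule always_eventually, rule allI)
      fix n
      obtain v where "smallest_eigenvalue (real_matrix a (Suc n))
          = (\<Sum>i\<le>Suc n. \<Sum>j\<le>Suc n. a i j * v i * v j)"
        using smallest_eigenvalue_attained[of a] sym by blast
      thus "0 \<le> smallest_eigenvalue (real_matrix a (Suc n))"
        using szego_kernel_nonneg[OF abs_node_less_1, where x = v and n = "Suc n"]
        by (simp add: a_def)
    qed
    show "\<forall>\<^sub>F n in sequentially. smallest_eigenvalue (real_matrix a (Suc n))
        \<le> (a n n + a (Suc n) (Suc n) - 2 * a n (Suc n)) / 2"
      using smallest_eigenvalue_le_pair[of a] sym by (intro always_eventually) blast
    show "(\<lambda>n. (a n n + a (Suc n) (Suc n) - 2 * a n (Suc n)) / 2) \<longlonglongrightarrow> 0"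
      using node_rayleigh_tendsto_0 by (simp add: a_def)
  qed
  ultimately show ?thesis using disk unfolding P[symmetric] by blast
qed

end
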